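(* Let $(U,xyz)$ be a left unital $(-1,-1)$ Freudenthal-Kantor triple system over $\mathbb{F}$ with left unit $e$. Then $\mu:x\mapsto exe$ is an involutive automorphism of $(U,xyz)$. Besides, consider the new $(-1,-1)$ Freudenthal-Kantor triple system $(U,\{xyz\})$ with $\{xyz\}=x\mu(y)z$. Then $\{eex\}=x=\{exe\}$ for any $x\in U$. Conversely, let $(U,\{xyz\})$ be a $(-1,-1)$ Freudenthal-Kantor triple system over $\mathbb{F}$ containing an element $e$ such that $\{eex\}=x=\{exe\}$ for any $x\in U$, and endowed with an involutive automorphism $\sigma$ such that $\sigma(e)=e$. Define a new triple product on $U$ by $xyz=\{x\sigma(y)z\}$. Then $(U,xyz)$ is a left unital $(-1,-1)$ Freudenthal-Kantor triple system with left unit $e$, $\sigma$ is an automorphism of $(U,xyz)$, and $\sigma=\mu$, where $\mu:x\mapsto exe$.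
   Context: $\mathbb{F}$ is a field of characteristic not two or three. A triple system is an $\mathbb{F}$-vector space $U$ with a trilinear product $(x,y,z)\mapsto xyz$. A $(-1,-1)$ Freudenthal-Kantor triple system is a triple system such that, with $L(x,y)z=xyz$ and $K(x,y)z=xzy+yzx$, one has for all $u,v,x,y\in U$: $[L(u,v),L(x,y)]=L(uvx,y)-L(x,vuy)$ and $K(K(u,v)x,y)=L(y,x)K(u,v)+K(u,v)L(x,y)$. It is left unital with left unit $e\in U$ if $eex=x$ for all $x\in U$. An automorphism of a triple system is a linear bijection preserving the triple product; it is involutive if its square is the identity. *)

theory Defs
  imports Complex_Main "HOL-Computational_Algebra.Computational_Algebra"
begin

text \<open>The underlying vector space is the whole type \<open>'u\<close>, with an explicit scalar
  multiplication by the field \<open>'f\<close>. A triple product \<open>xyz\<close> is the curried function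
  \<open>p x y z\<close>.\<close>

locale triple_system = vector_space scale
  for scale :: "'f::field \<Rightarrow> 'u::ab_group_add \<Rightarrow> 'u" +
  fixes p :: "'u \<Rightarrow> 'u \<Rightarrow> 'u \<Rightarrow> 'u"
  assumes linear_fst: "Vector_Spaces.linear scale scale (\<lambda>x. p x y z)"
    and linear_snd: "Vector_Spaces.linear scale scale (\<lambda>y. p x y z)"
    and linear_trd: "Vector_Spaces.linear scale scale (\<lambda>z. p x y z)"

definition L_op :: "('u \<Rightarrow> 'u \<Rightarrow> 'u \<Rightarrow> 'u) \<Rightarrow> 'u \<Rightarrow> 'u \<Rightarrow> 'u \<Rightarrow> 'u" where
  "L_op p x y = (\<lambda>z. p x y z)"

definition K_op :: "('u \<Rightarrow> 'u \<Rightarrow> 'u \<Rightarrow> 'u) \<Rightarrow> 'u \<Rightarrow> 'u \<Rightarrow> 'u \<Rightarrow> 'u::ab_group_add" where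
  "K_op p x y = (\<lambda>z. p x z y + p y z x)"

definition op_commutator :: "('u \<Rightarrow> 'u) \<Rightarrow> ('u \<Rightarrow> 'u) \<Rightarrow> 'u \<Rightarrow> 'u::ab_group_add" where
  "op_commutator f g = (\<lambda>z. f (g z) - g (f z))"

text \<open>The defining identities of a $(-1,-1)$ Freudenthal-Kantor triple system are equalities
  of operators; sums and differences of operators are written pointwise.\<close>

locale FK_triple_system = triple_system +
  assumes L_commutator: "op_commutator (L_op p u v) (L_op p x y) =
      (\<lambda>z. L_op p (p u v x) y z - L_op p x (p v u y) z)"
    and K_identity: "K_op p (K_op p u v x) y =
      (\<lambda>z. L_op p y x (K_op p u v z) + K_op p u v (L_op p x y z))"

definition left_unit :: "('u \<Rightarrow> 'u \<Rightarrow> 'u \<Rightarrow> 'u) \<Rightarrow> 'u \<Rightarrow> bool" where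
  "left_unit p e \<longleftrightarrow> (\<forall>x. p e e x = x)"

definition triple_automorphism ::
  "('f::field \<Rightarrow> 'u::ab_group_add \<Rightarrow> 'u) \<Rightarrow> ('u \<Rightarrow> 'u \<Rightarrow> 'u \<Rightarrow> 'u) \<Rightarrow> ('u \<Rightarrow> 'u) \<Rightarrow> bool" where
  "triple_automorphism scale p f \<longleftrightarrow>
     Vector_Spaces.linear scale scale f \<and> bij f \<and>
     (\<forall>x y z. f (p x y z) = p (f x) (f y) (f z))"

text \<open>Involutive only means that the square is the identity, so the identity map qualifies.\<close>

definition involutive_automorphism ::
  "('f::field \<Rightarrow> 'u::ab_group_add \<Rightarrow> 'u) \<Rightarrow> ('u \<Rightarrow> 'u \<Rightarrow> 'u \<Rightarrow> 'u) \<Rightarrow> ('u \<Rightarrow> 'u) \<Rightarrow> bool" where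
  "involutive_automorphism scale p f \<longleftrightarrow> triple_automorphism scale p f \<and> f \<circ> f = id"

definition mu :: "('u \<Rightarrow> 'u \<Rightarrow> 'u \<Rightarrow> 'u) \<Rightarrow> 'u \<Rightarrow> 'u \<Rightarrow> 'u" where
  "mu p e = (\<lambda>x. p e x e)"

definition twist :: "('u \<Rightarrow> 'u \<Rightarrow> 'u \<Rightarrow> 'u) \<Rightarrow> ('u \<Rightarrow> 'u) \<Rightarrow> 'u \<Rightarrow> 'u \<Rightarrow> 'u \<Rightarrow> 'u" where
  "twist p f = (\<lambda>x y z. p x (f y) z)"

end

theory Submission
  imports Defs
begin

text \<open>
  The substance is that $\mu(x) = exe$ preserves the triple product. Put $u = v = e$ in the
  \<open>K\<close>-identity: since $K(e,e) = 2\mu$, this gives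
  $\mu(x)zy + yz\mu(x) = yx\mu(z) + \mu(xyz)$, and $x = z = e$ yields $\mu^2 = 1$
  (lemmas \<open>mu_outer\<close>, \<open>mu_mu\<close>). Now consider the two products
  \[ [x,y,z] = x\,\mu(y)\,z, \qquad \langle x,y,z\rangle = \mu(\mu(x)\,y\,\mu(z)). \]
  The map $\mu$ is an automorphism exactly when they coincide. Before this is known, they satisfy
  identities that are interchanged when the products are swapped:
  \[ [u,v,[x,y,z]] = [[u,v,x],y,z] + [x,y,[u,v,z]] - [x,\langle v,u,y\rangle,z], \]
  \[ [a,c,b] + [b,c,a] = [b,a,c] + \langle a,b,c\rangle, \]
  and $e$ is a left unit with $[e,x,e] = x$ for both. So any consequence may be dualised, and
  comparing it with its dual gives information on the defect
  $d(a,b,c) = \langle a,b,c\rangle - [a,b,c]$, which changes sign under the duality.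

  The defect vanishes for all arguments as soon as it vanishes when the second argument is
  $e$: the commutator identity with $u = a$, $x = b$, $v = y = e$ expresses $[b,a,z]$
  through left multiplications $[\cdot,e,\cdot]$ alone, in the same way for both products
  (lemma \<open>products_agree\<close>). To see that $q(a,b) = d(a,e,b)$ vanishes, use the involution
  $\rho(x) = [x,e,e]$. The two identities and their duals make $q$ skew-symmetric and invariant
  under $\rho$ in each argument; hence $4q(a,b) = q(a + \rho a, b + \rho b)$, and on fixed points of
  $\rho$ a direct evaluation gives zero (lemmas \<open>defect_unit_skew\<close>,
  \<open>defect_unit_fixed_points\<close>, \<open>defect_unit\<close>).

  Twisting the middle argument by an involutive automorphism preserves the defining identities
  (lemma \<open>FK_twist\<close>). This serves both directions, and the remaining claims are immediate
  from $\mu(e) = e$, $\mu^2 = 1$ and $\sigma(e) = e$.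
\<close>

section \<open>Two dual triple products\<close>

text \<open>The identities shared by $[x,y,z] = x\,\mu(y)\,z$ (\<open>p\<close>) and
  $\langle x,y,z\rangle = \mu(\mu(x)\,y\,\mu(z))$ (\<open>n\<close>) in a left unital system. The
  assumptions are symmetric in the two products, so that every consequence holds with them
  exchanged.\<close>

locale dual_triple_products =
  fixes p n :: "'u::ab_group_add \<Rightarrow> 'u \<Rightarrow> 'u \<Rightarrow> 'u" and e :: 'u
  assumes two_torsion_free: "x + x = (0::'u) \<Longrightarrow> x = 0"
    and p_add_fst: "p (x + x') y z = p x y z + p x' y z"
    and p_add_trd: "p x y (z + z') = p x y z + p x y z'"
    and n_add_fst: "n (x + x') y z = n x y z + n x' y z"
    and n_add_trd: "n x y (z + z') = n x y z + n x y z'"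
    and p_commutator: "p u v (p x y z) = p (p u v x) y z + p x y (p u v z) - p x (n v u y) z"
    and n_commutator: "n u v (n x y z) = n (n u v x) y z + n x y (n u v z) - n x (p v u y) z"
    and p_outer: "p a c b + p b c a = p b a c + n a b c"
    and n_outer: "n a c b + n b c a = n b a c + p a b c"
    and p_unit_left: "p e e x = x"
    and p_unit_outer: "p e x e = x"
    and n_unit_left: "n e e x = x"
    and n_unit_outer: "n e x e = x"

sublocale dual_triple_products \<subseteq> dual: dual_triple_products n p e
  by unfold_locales
    (fact two_torsion_free n_add_fst n_add_trd p_add_fst p_add_trd n_commutator p_commutator
      n_outer p_outer n_unit_left n_unit_outer p_unit_left p_unit_outer)+

definition (in dual_triple_products) defect :: "'u \<Rightarrow> 'u \<Rightarrow> 'u \<Rightarrow> 'u" where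
  "defect a b c = n a b c - p a b c"

lemma (in dual_triple_products) dual_defect: "dual.defect a b c = - defect a b c"
  by (simp add: defect_def dual.defect_def)

text \<open>The left-hand side of the outer identity is symmetric in the outer arguments, so the right-hand
  side must be, too.\<close>

lemma (in dual_triple_products) defect_commute: "defect a b c = defect b a c"
proof -
  have "p b a c + n a b c = p a b c + n b a c"
    using p_outer[of a c b] p_outer[of b c a] by (simp add: add.commute)
  then show ?thesis by (simp add: defect_def algebra_simps)
qed

text \<open>The operator $K(a,b)$ is the same for both products. This makes it cancel whenever an identity
  is compared with its dual.\<close>

lemma (in dual_triple_products) outer_eq: "n a c b + n b c a = p a c b + p b c a"
proof -
  have "n b a c + p a b c = p b a c + n a b c"
    using defect_commute[of a b c] by (simp add: defect_def algebra_simps)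
  then show ?thesis by (simp add: p_outer n_outer)
qed

text \<open>The operator of the pair $(e,e)$ is the identity and commutes with everything, so only the
  correction terms of the commutator identity remain.\<close>

lemma (in dual_triple_products) shift_unit: "p (p u v e) e z = p e (n v u e) z"
  using p_commutator[of u v e e z] by (simp add: p_unit_left)

definition (in dual_triple_products) rho :: "'u \<Rightarrow> 'u" where "rho v = p v e e"

lemma (in dual_triple_products) rho_eq_dual: "n v e e = rho v"
  using shift_unit[of e v e] by (simp add: p_unit_outer rho_def)

lemma (in dual_triple_products) dual_rho: "dual.rho v = rho v"
  by (simp add: dual.rho_def rho_eq_dual)

lemma (in dual_triple_products) rho_add: "rho (x + y) = rho x + rho y"
  by (simp add: rho_def p_add_fst)

lemma (in dual_triple_products) rho_diff: "rho (x - y) = rho x - rho y"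
  using rho_add[of "x - y" y] by (simp add: algebra_simps)

lemma (in dual_triple_products) rho_product_unit: "rho (p u v e) = n v u e"
  using shift_unit[of u v e] by (simp add: p_unit_outer rho_def)

lemma (in dual_triple_products) rho_rho: "rho (rho v) = v"
  using rho_product_unit[of v e] by (simp add: n_unit_outer rho_def[of v])

lemma (in dual_triple_products) unit_mid: "p v e z = p e (rho v) z"
  using shift_unit[of e v z] by (simp add: p_unit_outer rho_eq_dual)

lemma (in dual_triple_products) unit_fst: "p e v z = p (rho v) e z"
  by (simp add: unit_mid rho_rho)

lemma (in dual_triple_products) defect_rho: "defect (rho v) e z = defect v e z"
  using defect_commute[of v e z] unit_fst dual.unit_fst by (simp add: defect_def dual_rho)

text \<open>How a left multiplication moves past $K(u,v)z = [u,z,v] + [v,z,u]$: apply the commutator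
  identity to both summands, with \<open>z\<close> in the middle position.\<close>

lemma (in dual_triple_products) outer_derivation:
  "p x y (p u z v + p v z u) + (p u (n y x z) v + p v (n y x z) u)
   = (p (p x y u) z v + p v z (p x y u)) + (p u z (p x y v) + p (p x y v) z u)"
  by (simp add: p_add_trd p_commutator[of x y u z v] p_commutator[of x y v z u] algebra_simps)

text \<open>The case $u = b$, $v = y = z = e$, where most terms can be evaluated. It is the source of
  the subsequent facts on the defect.\<close>

lemma (in dual_triple_products) outer_derivation_unit:
  "p a e b + p a e (rho b) + (p b a e + p e a b)
   = p a e b + rho (p a e b) + (p b e (rho a) + p (rho a) e b)"
  using outer_derivation[of a e b e e]
  by (simp add: p_add_trd n_unit_outer p_unit_left rho_def algebra_simps)

text \<open>Compare the preceding identity with its dual: all summands are values of \<open>K\<close> except those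
  of the form $[a,e,\cdot]$ or $\rho[a,e,\cdot]$.\<close>

lemma (in dual_triple_products) defect_unit_rho_trd: "defect a e (rho b) = rho (defect a e b)"
proof -
  have "n a e b + n a e (rho b) + (n b a e + n e a b)
     = n a e b + rho (n a e b) + (n b e (rho a) + n (rho a) e b)"
    using dual.outer_derivation_unit[of a b] by (simp add: dual_rho)
  then have 1: "n a e (rho b) - rho (n a e b) = (n b e (rho a) + n (rho a) e b) - (n b a e + n e a b)"
    by (simp add: algebra_simps)
  have 2: "p a e (rho b) - rho (p a e b) = (p b e (rho a) + p (rho a) e b) - (p b a e + p e a b)"
    using outer_derivation_unit[of a b] by (simp add: algebra_simps)
  have "n a e (rho b) - rho (n a e b) = p a e (rho b) - rho (p a e b)"
    unfolding 1 2 by (simp add: outer_eq)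
  then show ?thesis by (simp add: defect_def rho_diff algebra_simps)
qed

text \<open>The outer identity splits the term $K(b,e)a$ of \<open>outer_derivation_unit\<close> into values of
  $[\cdot,e,\cdot]$ and a defect. The defect is thereby determined by the bilinear product
  $(a,b) \mapsto [a,e,b]$ and $\rho$.\<close>

lemma (in dual_triple_products) defect_unit_formula:
  "defect b e a = rho (p a e b) - p a e (rho b) + p b e (rho a)
     + p (rho a) e b - p (rho b) e a - p b e a"
proof -
  have "p b a e + p e a b = p (rho b) e a + p b e a + defect b e a"
    using p_outer[of b a e] by (simp add: defect_def unit_fst)
  then show ?thesis using outer_derivation_unit[of a b] by (simp add: algebra_simps)
qed

text \<open>Subtract the formula for the defect from its dual. The left-hand side changes sign, and the
  right-hand side becomes a sum of defects.\<close>

lemma (in dual_triple_products) defect_unit_twist: "defect a e b = - defect b e (rho a)"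
proof -
  have dual: "- defect b e a = rho (n a e b) - n a e (rho b) + n b e (rho a)
      + n (rho a) e b - n (rho b) e a - n b e a"
    using dual.defect_unit_formula[of b a] by (simp only: dual_defect dual_rho)
  have "- defect b e a - defect b e a = rho (defect a e b) - defect a e (rho b) + defect b e (rho a)
      + defect (rho a) e b - defect (rho b) e a - defect b e a"
    using arg_cong2[where f = minus, OF dual defect_unit_formula[of b a]]
    unfolding defect_def rho_diff by (simp add: algebra_simps)
  then have "defect a e b + defect b e (rho a) = 0"
    by (simp add: defect_rho defect_unit_rho_trd algebra_simps)
  then show ?thesis by (simp add: eq_neg_iff_add_eq_0)
qed

lemma (in dual_triple_products) defect_unit_skew: "defect a e b = - defect b e a"
  using defect_unit_twist[of "rho a" b] by (simp add: defect_rho rho_rho)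

text \<open>By the outer identity the cyclic sum of the defect is zero. Its two other terms have \<open>e\<close> in one
  of the first two positions and cancel by skew-symmetry.\<close>

lemma (in dual_triple_products) defect_unit_trd: "defect a b e = 0"
proof -
  have formula: "defect x y z = p x z y + p y z x - p y x z - p x y z" for x y z
    using p_outer[of x z y] by (simp add: defect_def)
  have "defect a b e = - (defect a e b + defect b e a)"
    unfolding defect_commute[of a e] by (simp add: formula)
  also have "\<dots> = 0" by (simp add: defect_unit_skew[of a b])
  finally show ?thesis .
qed

lemma (in dual_triple_products) rho_swaps_unit_product: "rho (p a b e) = p b a e"
  using rho_product_unit[of a b] defect_unit_trd[of b a] by (simp add: defect_def)

text \<open>Evaluate $[b,a,e]$ in terms of $[\cdot,e,\cdot]$. As $\rho$ maps $[a,b,e]$ to $[b,a,e]$,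
  the two evaluations force $\rho[b,e,a] = [a,e,b]$, and the formula for the defect collapses.\<close>

lemma (in dual_triple_products) defect_unit_fixed_points:
  assumes a: "rho a = a" and b: "rho b = b"
  shows "defect b e a = 0"
proof -
  have ba: "p b a e = rho (p a e b) + p b e a - p a e b"
    using outer_derivation_unit[of a b] by (simp add: a b unit_fst[of a b] algebra_simps)
  have ab: "p a b e = rho (p b e a) + p a e b - p b e a"
    using outer_derivation_unit[of b a] by (simp add: a b unit_fst[of b a] algebra_simps)
  have "rho (p b e a) = p a e b"
    using rho_swaps_unit_product[of a b] unfolding ab ba
    by (simp add: rho_add rho_diff rho_rho algebra_simps)
  then have "rho (p a e b) = p b e a" using rho_rho by metis
  then show ?thesis using defect_unit_formula[of b a] by (simp add: a b)
qed

text \<open>By invariance under $\rho$ it suffices to consider the fixed points $a + \rho a$ and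
  $b + \rho b$; the absence of two-torsion removes the resulting factor four.\<close>

lemma (in dual_triple_products) defect_unit: "defect a e b = 0"
proof -
  have inv: "defect x e (rho y) = defect x e y" for x y
    using defect_unit_twist[of y x] defect_unit_skew[of y x] by simp
  have "defect (a + rho a) e (b + rho b) = 0"
    by (rule defect_unit_fixed_points) (simp_all add: rho_add rho_rho add.commute)
  moreover have "defect (a + rho a) e (b + rho b)
      = (defect a e b + defect (rho a) e b) + (defect a e (rho b) + defect (rho a) e (rho b))"
    by (simp add: defect_def p_add_fst p_add_trd n_add_fst n_add_trd algebra_simps)
  ultimately have "(defect a e b + defect a e b) + (defect a e b + defect a e b) = 0"
    by (simp add: defect_rho inv)
  then show ?thesis by (blast dest: two_torsion_free)
qed

text \<open>Left multiplications of the form $[\cdot,e,\cdot]$ agree for the two products, and every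
  other left multiplication is a combination of these and of their commutators.\<close>

lemma (in dual_triple_products) products_agree: "n a b c = p a b c"
proof -
  have unit: "n x e y = p x e y" for x y
    using defect_unit[of x y] by (simp add: defect_def)
  have "n a b c = n (n b e a) e c + n a e (n b e c) - n b e (n a e c)"
    using n_commutator[of b e a e c] by (simp add: p_unit_outer)
  also have "\<dots> = p (p b e a) e c + p a e (p b e c) - p b e (p a e c)"
    by (simp only: unit)
  also have "\<dots> = p a b c"
    using p_commutator[of b e a e c] by (simp add: n_unit_outer)
  finally show ?thesis .
qed

section \<open>Freudenthal-Kantor triple systems\<close>

lemma vector_space_two_torsion_free:
  fixes scale :: "'f::field \<Rightarrow> 'u::ab_group_add \<Rightarrow> 'u"
  assumes "vector_space scale" and "CHAR('f) \<noteq> 2" and "x + x = (0::'u)"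
  shows "x = 0"
proof -
  interpret vector_space scale by (fact assms(1))
  have "(2::'f) \<noteq> 0"
  proof
    assume "(2::'f) = 0"
    then have "CHAR('f) dvd 2"
      using of_nat_eq_0_iff_char_dvd[where 'a='f, of 2] by simp
    moreover have "CHAR('f) \<noteq> 1"
      by simp
    ultimately show False
      using assms(2) two_is_prime_nat by (auto simp: prime_nat_iff)
  qed
  moreover have "scale 2 x = 0"
    using assms(3) scale_left_distrib[of 1 1 x] by simp
  ultimately show ?thesis by simp
qed

context FK_triple_system
begin

lemma p_add:
  "p (x + x') y z = p x y z + p x' y z"
  "p x (y + y') z = p x y z + p x y' z"
  "p x y (z + z') = p x y z + p x y z'"
  using linear_fst linear_snd linear_trd by (simp_all add: Vector_Spaces.linear_iff)

lemma commutator: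
  "p u v (p x y z) = p (p u v x) y z + p x y (p u v z) - p x (p v u y) z"
  using fun_cong[OF L_commutator[of u v x y], of z]
  by (simp add: op_commutator_def L_op_def algebra_simps)

lemma outer:
  "p (p u x v + p v x u) z y + p y z (p u x v + p v x u)
    = p y x (p u z v + p v z u) + (p u (p x y z) v + p v (p x y z) u)"
  using fun_cong[OF K_identity[of u v x y], of z]
  by (simp add: K_op_def L_op_def)

text \<open>The twisted operators are $L'(x,y) = L(x,\sigma y)$ and $K'(x,y) = K(x,y)\sigma$. The middle
  argument on the right of the commutator identity needs both properties of \<open>\<sigma>\<close>:
  $\sigma(v\,\sigma(u)\,y) = \sigma(v)\,u\,\sigma(y)$.\<close>

lemma FK_twist:
  assumes "involutive_automorphism scale p \<sigma>"
  shows "FK_triple_system scale (twist p \<sigma>)"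
proof -
  have lin: "Vector_Spaces.linear scale scale \<sigma>" and hom: "\<sigma> (p x y z) = p (\<sigma> x) (\<sigma> y) (\<sigma> z)"
    and inv: "\<sigma> (\<sigma> x) = x" for x y z
    using assms unfolding involutive_automorphism_def triple_automorphism_def
    by (auto dest: fun_cong)
  show ?thesis
  proof (intro FK_triple_system.intro triple_system.intro triple_system_axioms.intro
      FK_triple_system_axioms.intro vector_space_axioms)
    show "Vector_Spaces.linear scale scale (\<lambda>x. twist p \<sigma> x y z)" for y z
      using linear_fst by (simp add: twist_def)
    show "Vector_Spaces.linear scale scale (\<lambda>y. twist p \<sigma> x y z)" for x z
      using Vector_Spaces.linear_compose[OF lin linear_snd] by (simp add: twist_def o_def)
    show "Vector_Spaces.linear scale scale (\<lambda>z. twist p \<sigma> x y z)" for x y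
      using linear_trd by (simp add: twist_def)
    show "op_commutator (L_op (twist p \<sigma>) u v) (L_op (twist p \<sigma>) x y) =
      (\<lambda>z. L_op (twist p \<sigma>) (twist p \<sigma> u v x) y z - L_op (twist p \<sigma>) x (twist p \<sigma> v u y) z)"
      for u v x y
      using commutator[of u "\<sigma> v" x "\<sigma> y"]
      by (simp add: op_commutator_def L_op_def twist_def hom inv fun_eq_iff algebra_simps)
    show "K_op (twist p \<sigma>) (K_op (twist p \<sigma>) u v x) y =
      (\<lambda>z. L_op (twist p \<sigma>) y x (K_op (twist p \<sigma>) u v z)
         + K_op (twist p \<sigma>) u v (L_op (twist p \<sigma>) x y z))" for u v x y
      using outer[of u "\<sigma> x" v "\<sigma> _" y]
      by (simp add: K_op_def L_op_def twist_def hom inv fun_eq_iff)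
  qed
qed

end

locale left_unital_FK_triple_system = FK_triple_system scale p
  for scale :: "'f::field \<Rightarrow> 'u::ab_group_add \<Rightarrow> 'u" and p +
  fixes e :: 'u
  assumes unit: "p e e x = x"
    and char_not_2: "CHAR('f) \<noteq> 2"
begin

abbreviation \<mu> :: "'u \<Rightarrow> 'u" where "\<mu> \<equiv> mu p e"

lemma mu_add: "\<mu> (x + y) = \<mu> x + \<mu> y"
  by (simp add: mu_def p_add)

lemma mu_diff: "\<mu> (x - y) = \<mu> x - \<mu> y"
  using mu_add[of "x - y" y] by (simp add: algebra_simps)

lemma linear_mu: "Vector_Spaces.linear scale scale \<mu>"
  unfolding mu_def by (rule linear_snd)

lemma mu_unit: "\<mu> e = e"
  by (simp add: mu_def unit)

text \<open>The \<open>K\<close>-identity for $K(e,e) = 2\mu$, divided by two.\<close>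

lemma mu_outer: "p (\<mu> x) z y + p y z (\<mu> x) = p y x (\<mu> z) + \<mu> (p x y z)"
proof -
  let ?d = "(p (\<mu> x) z y + p y z (\<mu> x)) - (p y x (\<mu> z) + \<mu> (p x y z))"
  have "?d + ?d = 0"
    using outer[of e x e z y] by (simp add: mu_def p_add algebra_simps)
  then show ?thesis using vector_space_two_torsion_free[OF vector_space_axioms char_not_2, of ?d] by simp
qed

lemma mu_mu: "\<mu> (\<mu> x) = x"
  using mu_outer[of e e x] by (simp add: mu_unit unit) (simp add: mu_def)

text \<open>The outer identities are \<open>mu_outer\<close> and its image under $\mu$; the mixed term in the
  commutator identities arises because $\mu(\mu(v)\,u\,\mu(y))$ is the second product of
  $v$, $u$, $y$.\<close>

lemma dual_twisted_products:
  "dual_triple_products (\<lambda>x y z. p x (\<mu> y) z) (\<lambda>x y z. \<mu> (p (\<mu> x) y (\<mu> z))) e"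
proof
  show "x + x = 0 \<Longrightarrow> x = 0" for x :: 'u
    by (rule vector_space_two_torsion_free[OF vector_space_axioms char_not_2])
  show "p a (\<mu> c) b + p b (\<mu> c) a = p b (\<mu> a) c + \<mu> (p (\<mu> a) b (\<mu> c))" for a b c
    using mu_outer[of "\<mu> a" "\<mu> c" b] by (simp add: mu_mu)
  show "\<mu> (p (\<mu> a) c (\<mu> b)) + \<mu> (p (\<mu> b) c (\<mu> a)) = \<mu> (p (\<mu> b) a (\<mu> c)) + p a (\<mu> b) c" for a b c
    using arg_cong[OF mu_outer[of a c "\<mu> b"], of \<mu>] by (simp add: mu_mu mu_add)
  show "p u (\<mu> v) (p x (\<mu> y) z) = p (p u (\<mu> v) x) (\<mu> y) z + p x (\<mu> y) (p u (\<mu> v) z)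
      - p x (\<mu> (\<mu> (p (\<mu> v) u (\<mu> y)))) z" for u v x y z
    using commutator[of u "\<mu> v" x "\<mu> y" z] by (simp only: mu_mu)
  show "\<mu> (p (\<mu> u) v (\<mu> (\<mu> (p (\<mu> x) y (\<mu> z)))))
      = \<mu> (p (\<mu> (\<mu> (p (\<mu> u) v (\<mu> x)))) y (\<mu> z))
        + \<mu> (p (\<mu> x) y (\<mu> (\<mu> (p (\<mu> u) v (\<mu> z))))) - \<mu> (p (\<mu> x) (p v (\<mu> u) y) (\<mu> z))"
    for u v x y z
    using commutator[of "\<mu> u" v "\<mu> x" y "\<mu> z"] by (simp only: mu_mu mu_add mu_diff)
  show "p e (\<mu> x) e = x" and "\<mu> (p (\<mu> e) x (\<mu> e)) = x" for x
    using mu_mu[of x] mu_unit by (simp_all add: mu_def)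
  show "\<mu> (p (\<mu> e) e (\<mu> x)) = x" for x by (simp add: mu_mu mu_unit unit)
  show "p e (\<mu> e) x = x" for x by (simp add: mu_unit unit)
qed (simp_all only: p_add mu_add)

lemma mu_hom: "\<mu> (p x y z) = p (\<mu> x) (\<mu> y) (\<mu> z)"
  using dual_triple_products.products_agree[OF dual_twisted_products, of "\<mu> x" y "\<mu> z"] by (simp add: mu_mu)

lemma mu_involutive_automorphism: "involutive_automorphism scale p \<mu>"
proof -
  have "\<mu> \<circ> \<mu> = id" by (simp add: fun_eq_iff mu_mu)
  moreover from this have "bij \<mu>" by (blast intro: o_bij)
  ultimately show ?thesis
    by (simp add: involutive_automorphism_def triple_automorphism_def linear_mu mu_hom)
qed

end

section \<open>Left unital systems and involutive automorphisms\<close>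

theorem theorem3p8:
  fixes scale :: "'f::field \<Rightarrow> 'u::ab_group_add \<Rightarrow> 'u"
  assumes "CHAR('f) \<noteq> 2" and "CHAR('f) \<noteq> 3"
  shows "(\<forall>(p :: 'u \<Rightarrow> 'u \<Rightarrow> 'u \<Rightarrow> 'u) e.
            FK_triple_system scale p \<and> left_unit p e \<longrightarrow>
              involutive_automorphism scale p (mu p e) \<and>
              FK_triple_system scale (twist p (mu p e)) \<and>
              (\<forall>x. twist p (mu p e) e e x = x \<and> twist p (mu p e) e x e = x))
       \<and> (\<forall>(q :: 'u \<Rightarrow> 'u \<Rightarrow> 'u \<Rightarrow> 'u) e \<sigma>.
            FK_triple_system scale q \<and> (\<forall>x. q e e x = x \<and> q e x e = x) \<and>
            involutive_automorphism scale q \<sigma> \<and> \<sigma> e = e \<longrightarrow>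
              FK_triple_system scale (twist q \<sigma>) \<and>
              left_unit (twist q \<sigma>) e \<and>
              triple_automorphism scale (twist q \<sigma>) \<sigma> \<and>
              \<sigma> = mu (twist q \<sigma>) e)"
proof (intro conjI allI impI; elim conjE)
  fix p :: "'u \<Rightarrow> 'u \<Rightarrow> 'u \<Rightarrow> 'u" and e x
  assume "FK_triple_system scale p" and "left_unit p e"
  then interpret left_unital_FK_triple_system scale p e
    using assms(1)
    by (simp add: left_unital_FK_triple_system_def left_unital_FK_triple_system_axioms_def left_unit_def)
  show "involutive_automorphism scale p (mu p e)"
    by (rule mu_involutive_automorphism)
  then show "FK_triple_system scale (twist p (mu p e))"
    by (rule FK_twist)
  show "twist p (mu p e) e e x = x"
    by (simp add: twist_def mu_unit unit)
  show "twist p (mu p e) e x e = x"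
    using mu_mu[of x] by (simp add: twist_def mu_def)
next
  fix q :: "'u \<Rightarrow> 'u \<Rightarrow> 'u \<Rightarrow> 'u" and e \<sigma>
  assume q: "FK_triple_system scale q" and e: "\<forall>x. q e e x = x \<and> q e x e = x"
    and \<sigma>: "involutive_automorphism scale q \<sigma>" and \<sigma>e: "\<sigma> e = e"
  show "FK_triple_system scale (twist q \<sigma>)"
    by (rule FK_triple_system.FK_twist[OF q \<sigma>])
  show "left_unit (twist q \<sigma>) e"
    by (simp add: left_unit_def twist_def \<sigma>e e)
  show "triple_automorphism scale (twist q \<sigma>) \<sigma>"
    using \<sigma> by (simp add: involutive_automorphism_def triple_automorphism_def twist_def)
  show "\<sigma> = mu (twist q \<sigma>) e"
    by (simp add: mu_def twist_def e fun_eq_iff)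
qed

end
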